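(* Let $k$ be a field of characteristic $p>0$ and let $\{f_n(x)\}_{n\in\mathbb{N}}$ be a chain in $k[x]$. Then $\{f_n(x)\}_{n\in\mathbb{N}}$ is similar to exactly one of the two chains $\{x^n\}_{n\in\mathbb{N}}$ and $\{G_n(x)\}_{n\in\mathbb{N}}$, where $G_n(x):=F_n(x) \bmod p$.
   Context: $\mathbb{N}$ denotes the positive integers. A chain in $k[x]$ is a family $\{f_n(x)\}_{n\in\mathbb{N}}\subset k[x]$ with $\deg f_n=n$ for every $n$ and such that any two members commute under composition: $f_m(f_n(x))=f_n(f_m(x))$ for all $m,n$. Two chains $\{f_n\}$ and $\{g_n\}$ in $k[x]$ are similar if there is $\lambda(x)=ax+b\in k[x]$ with $a\neq 0$ such that $g_n(x)=\lambda^{-1}(f_n(\lambda(x)))$ for all $n$. $T_n(x)$ is the Chebyshev polynomial of the first kind: $T_0=1$, $T_1=x$, $T_n=2xT_{n-1}-T_{n-2}$ for $n\ge2$. $F_n(x)=2T_n\left(\frac{x}{2}+1\right)-2$, which is a monic polynomial of degree $n$ with integer coefficients; $G_n$ is the image of $F_n$ in $k[x]$ obtained by reducing coefficients modulo $p$. *)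

theory Defs
  imports "HOL-Computational_Algebra.Computational_Algebra"
begin

text \<open>
  Families of polynomials indexed by the positive integers are functions on \<^typ>\<open>nat\<close>;
  the value at index 0 is irrelevant and is never constrained or compared.
\<close>

definition is_chain :: "(nat \<Rightarrow> 'a::field poly) \<Rightarrow> bool" where
  "is_chain f \<longleftrightarrow>
     (\<forall>n\<ge>1. degree (f n) = n) \<and>
     (\<forall>m\<ge>1. \<forall>n\<ge>1. f m \<circ>\<^sub>p f n = f n \<circ>\<^sub>p f m)"

text \<open>The polynomial \<open>a x + b\<close> and, for nonzero \<open>a\<close>, its compositional inverse \<open>(x - b) / a\<close>.\<close>

definition linear_poly :: "'a::field \<Rightarrow> 'a \<Rightarrow> 'a poly" where
  "linear_poly a b = [:b, a:]"

definition linear_poly_inv :: "'a::field \<Rightarrow> 'a \<Rightarrow> 'a poly" where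
  "linear_poly_inv a b = [:- b / a, 1 / a:]"

lemma linear_poly_inv:
  assumes "a \<noteq> 0"
  shows "linear_poly a b \<circ>\<^sub>p linear_poly_inv a b = [:0, 1:]"
    and "linear_poly_inv a b \<circ>\<^sub>p linear_poly a b = [:0, 1:]"
  using assms by (simp_all add: linear_poly_def linear_poly_inv_def pcompose_pCons)

definition similar_chains :: "(nat \<Rightarrow> 'a::field poly) \<Rightarrow> (nat \<Rightarrow> 'a poly) \<Rightarrow> bool" where
  "similar_chains f g \<longleftrightarrow>
     (\<exists>a b. a \<noteq> 0 \<and>
        (\<forall>n\<ge>1. g n = linear_poly_inv a b \<circ>\<^sub>p (f n \<circ>\<^sub>p linear_poly a b)))"

fun cheb_T :: "nat \<Rightarrow> 'a::comm_ring_1 poly" where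
  "cheb_T 0 = 1"
| "cheb_T (Suc 0) = [:0, 1:]"
| "cheb_T (Suc (Suc n)) = [:0, 2:] * cheb_T (Suc n) - cheb_T n"

definition F_rat :: "nat \<Rightarrow> rat poly" where
  "F_rat n = smult 2 (cheb_T n \<circ>\<^sub>p [:1, 1 / 2:]) - [:2:]"

text \<open>
  The defining formula needs the inverse of 2, so it is read over the rationals; the resulting
  polynomial has integer coefficients (lemma \<open>F_int\<close> below), and this integer polynomial is
  what gets reduced.  In particular the reduction makes sense in characteristic 2.
\<close>

definition F_int :: "nat \<Rightarrow> int poly" where
  "F_int n = (THE q. map_poly of_int q = F_rat n)"

definition G_poly :: "nat \<Rightarrow> 'a::field poly" where
  "G_poly n = map_poly of_int (F_int n)"

lemma F_rat_rec:
  "F_rat (Suc (Suc n)) = [:2, 1:] * F_rat (Suc n) - F_rat n + [:0, 2:]"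
proof -
  define A B where "A = cheb_T (Suc n) \<circ>\<^sub>p [:1, 1 / 2 :: rat:]"
    and "B = cheb_T n \<circ>\<^sub>p [:1, 1 / 2 :: rat:]"
  have "F_rat (Suc (Suc n)) = smult 2 ([:2, 1:] * A - B) - [:2:]"
    by (simp add: F_rat_def A_def B_def pcompose_diff pcompose_mult pcompose_pCons pcompose_smult
        smult_add_right smult_diff_right)
  also have "\<dots> = [:2, 1:] * (smult 2 A - [:2:]) - (smult 2 B - [:2:]) + [:0, 2:]"
    by (rule poly_eqI) (simp add: coeff_pCons algebra_simps split: nat.split)
  finally show ?thesis by (simp only: F_rat_def A_def B_def)
qed

text \<open>The integer polynomials given by the recursion witness that \<open>F_int\<close> is well defined.\<close>

fun F_aux :: "nat \<Rightarrow> int poly" where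
  "F_aux 0 = 0"
| "F_aux (Suc 0) = [:0, 1:]"
| "F_aux (Suc (Suc n)) = [:2, 1:] * F_aux (Suc n) - F_aux n + [:0, 2:]"

lemma F_aux_monic:
  "degree (F_aux n) = n \<and> (n \<ge> 1 \<longrightarrow> coeff (F_aux n) n = 1)"
proof (induction n rule: F_aux.induct)
  case (3 n)
  have le: "degree (F_aux (Suc (Suc n))) \<le> Suc (Suc n)"
  proof (rule degree_le, intro allI impI)
    fix i assume i: "Suc (Suc n) < i"
    then obtain j where j: "i = Suc j" "Suc n < j" by (cases i) auto
    have "coeff (F_aux (Suc n)) i = 0" "coeff (F_aux (Suc n)) j = 0" "coeff (F_aux n) i = 0"
      using 3 i j by (auto intro!: coeff_eq_0)
    then show "coeff (F_aux (Suc (Suc n))) i = 0"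
      using j by (simp add: coeff_pCons split: nat.split)
  qed
  have "coeff (F_aux (Suc n)) (Suc (Suc n)) = 0" "coeff (F_aux n) (Suc (Suc n)) = 0"
    using 3 by (auto intro!: coeff_eq_0)
  then have c: "coeff (F_aux (Suc (Suc n))) (Suc (Suc n)) = 1"
    using 3 by simp
  then have "degree (F_aux (Suc (Suc n))) \<ge> Suc (Suc n)"
    by (intro le_degree) simp
  with le have "degree (F_aux (Suc (Suc n))) = Suc (Suc n)" by (rule antisym)
  with c show ?case by (simp only:) simp
qed auto

lemma of_int_F_aux: "map_poly of_int (F_aux n) = F_rat n"
proof (induction n rule: F_aux.induct)
  case (3 n)
  have "map_poly of_int (F_aux (Suc (Suc n))) =
    ([:2, 1:] * map_poly of_int (F_aux (Suc n)) - map_poly of_int (F_aux n) + [:0, 2:] :: rat poly)"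
    by (rule poly_eqI) (simp add: coeff_map_poly coeff_pCons split: nat.split)
  with 3 show ?case by (simp only: F_rat_rec)
qed (simp_all add: F_rat_def pcompose_pCons pcompose_1 map_poly_pCons numeral_poly one_pCons)

lemma F_int:
  "map_poly of_int (F_int n) = F_rat n"
  "degree (F_int n) = n"
  "n \<ge> 1 \<Longrightarrow> lead_coeff (F_int n) = 1"
proof -
  have "F_int n = F_aux n"
    unfolding F_int_def
  proof (rule the_equality)
    show "map_poly of_int (F_aux n) = F_rat n" by (rule of_int_F_aux)
    fix q :: "int poly" assume "map_poly of_int q = F_rat n"
    then have "map_poly of_int q = (map_poly of_int (F_aux n) :: rat poly)"
      by (simp add: of_int_F_aux)
    then show "q = F_aux n"
      by (auto simp: poly_eq_iff coeff_map_poly)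
  qed
  then show "map_poly of_int (F_int n) = F_rat n" "degree (F_int n) = n"
    "n \<ge> 1 \<Longrightarrow> lead_coeff (F_int n) = 1"
    using F_aux_monic[of n] of_int_F_aux[of n] by auto
qed

end

theory Submission
  imports Defs
begin

text \<open>
  Scaling makes \<open>f\<^sub>2\<close>, and hence every \<open>f\<^sub>n\<close>, monic. A degree count shows that a polynomial
  of degree \<open>m \<in> {2, 3}\<close>, with \<open>m\<close> nonzero in the field, commutes with at most one monic
  polynomial of each positive degree; so the chain is determined by \<open>f\<^sub>2\<close> if \<open>2 \<noteq> 0\<close> and by
  \<open>f\<^sub>3\<close> if \<open>2 = 0\<close>. If \<open>2 \<noteq> 0\<close>, a translation gives \<open>f\<^sub>2 = x\<^sup>2 + c\<close>, and commutation with \<open>f\<^sub>3\<close>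
  forces \<open>3 c (c + 2) = 0\<close>; if \<open>3 = 0\<close> it still forces \<open>c\<^sup>3 = c\<close>, and the remaining value
  \<open>c = -1\<close> is ruled out by \<open>f\<^sub>5\<close>. If \<open>2 = 0\<close>, a translation gives \<open>f\<^sub>3 = x\<^sup>3 + a x + d\<close>;
  commutation with \<open>f\<^sub>2\<close> gives \<open>f\<^sub>2 = x\<^sup>2\<close>, \<open>a\<^sup>2 = a\<close>, \<open>d\<^sup>2 = d\<close>, and \<open>f\<^sub>5\<close> forces \<open>d = 0\<close>.
\<close>

section \<open>Similarity as an equivalence relation\<close>

lemma pcompose_X_left: "[:0, 1:] \<circ>\<^sub>p q = (q :: 'a::comm_semiring_1 poly)"
  by (simp add: pcompose_pCons)

lemma pcompose_monom: "monom 1 n \<circ>\<^sub>p q = (q :: 'a::comm_semiring_1 poly) ^ n"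
  by (induction n) (simp_all add: pcompose_pCons pcompose_1 monom_Suc)

text \<open>Composing with \<open>linear_poly a b\<close> on the left cancels the inverse. Symmetry
  and transitivity then reduce to associativity of composition.\<close>

lemma similar_chains_iff:
  fixes f g :: "nat \<Rightarrow> 'a::field poly"
  shows "similar_chains f g \<longleftrightarrow>
     (\<exists>a b. a \<noteq> 0 \<and> (\<forall>n\<ge>1. linear_poly a b \<circ>\<^sub>p g n = f n \<circ>\<^sub>p linear_poly a b))"
proof -
  have "P = linear_poly_inv a b \<circ>\<^sub>p (Q \<circ>\<^sub>p linear_poly a b) \<longleftrightarrow>
        linear_poly a b \<circ>\<^sub>p P = Q \<circ>\<^sub>p linear_poly a b" if "a \<noteq> 0" for a b :: 'a and P Q
  proof
    assume "P = linear_poly_inv a b \<circ>\<^sub>p (Q \<circ>\<^sub>p linear_poly a b)"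
    then show "linear_poly a b \<circ>\<^sub>p P = Q \<circ>\<^sub>p linear_poly a b"
      using linear_poly_inv(1)[OF that, of b] by (simp add: pcompose_assoc pcompose_X_left)
  next
    assume "linear_poly a b \<circ>\<^sub>p P = Q \<circ>\<^sub>p linear_poly a b"
    then show "P = linear_poly_inv a b \<circ>\<^sub>p (Q \<circ>\<^sub>p linear_poly a b)"
      using linear_poly_inv(2)[OF that, of b] pcompose_assoc pcompose_X_left by metis
  qed
  then show ?thesis
    unfolding similar_chains_def by (intro ex_cong1 conj_cong refl) blast
qed

lemma linear_poly_inv_conv: "a \<noteq> 0 \<Longrightarrow> linear_poly_inv a b = linear_poly (1 / a) (- b / a)"
  by (simp add: linear_poly_def linear_poly_inv_def)

lemma similar_chains_if_eq: "(\<And>n. n \<ge> 1 \<Longrightarrow> f n = g n) \<Longrightarrow> similar_chains f g"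
  unfolding similar_chains_iff
  by (intro exI[of _ 1] exI[of _ 0]) (simp add: linear_poly_def pcompose_X_left)

lemma similar_chains_sym:
  assumes "similar_chains f g"
  shows "similar_chains g f"
proof -
  obtain a b where a: "a \<noteq> 0"
    and eq: "\<And>n. n \<ge> 1 \<Longrightarrow> linear_poly a b \<circ>\<^sub>p g n = f n \<circ>\<^sub>p linear_poly a b"
    using assms by (auto simp: similar_chains_iff)
  have "linear_poly_inv a b \<circ>\<^sub>p f n = g n \<circ>\<^sub>p linear_poly_inv a b" if "n \<ge> 1" for n
    using linear_poly_inv[OF a] eq[OF that] by (metis pcompose_assoc pcompose_idR pcompose_X_left)
  with a show ?thesis
    unfolding similar_chains_iff linear_poly_inv_conv[OF a]
    by (intro exI[of _ "1 / a"] exI[of _ "- b / a"]) simp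
qed

lemma similar_chains_trans:
  assumes "similar_chains f g" "similar_chains g h"
  shows "similar_chains f h"
proof -
  obtain a b where a: "a \<noteq> 0"
    and fg: "\<And>n. n \<ge> 1 \<Longrightarrow> linear_poly a b \<circ>\<^sub>p g n = f n \<circ>\<^sub>p linear_poly a b"
    using assms by (auto simp: similar_chains_iff)
  obtain c d where c: "c \<noteq> 0"
    and gh: "\<And>n. n \<ge> 1 \<Longrightarrow> linear_poly c d \<circ>\<^sub>p h n = g n \<circ>\<^sub>p linear_poly c d"
    using assms by (auto simp: similar_chains_iff)
  have L: "linear_poly (a * c) (a * d + b) = linear_poly a b \<circ>\<^sub>p linear_poly c d"
    by (simp add: linear_poly_def pcompose_pCons)
  have "linear_poly (a * c) (a * d + b) \<circ>\<^sub>p h n = f n \<circ>\<^sub>p linear_poly (a * c) (a * d + b)"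
    if "n \<ge> 1" for n
    unfolding L using fg[OF that] gh[OF that] by (metis pcompose_assoc)
  with a c show ?thesis
    unfolding similar_chains_iff
    by (intro exI[of _ "a * c"] exI[of _ "a * d + b"]) simp
qed

definition conj_chain :: "'a::field \<Rightarrow> 'a \<Rightarrow> (nat \<Rightarrow> 'a poly) \<Rightarrow> nat \<Rightarrow> 'a poly" where
  "conj_chain a b f n = linear_poly_inv a b \<circ>\<^sub>p (f n \<circ>\<^sub>p linear_poly a b)"

lemma similar_conj_chain: "a \<noteq> 0 \<Longrightarrow> similar_chains f (conj_chain a b f)"
  by (auto simp: similar_chains_def conj_chain_def)

lemma is_chain_conj_chain:
  assumes "is_chain f" "a \<noteq> 0"
  shows "is_chain (conj_chain a b f)"
proof -
  have "degree (conj_chain a b f n) = n" if "n \<ge> 1" for n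
    using assms that
    by (simp add: is_chain_def conj_chain_def linear_poly_def linear_poly_inv_def degree_pcompose)
  \<comment> \<open>The constant family, taken at the dummy index 0, expresses the conjugate of the
    single polynomial \<open>f m \<circ>\<^sub>p f n\<close>, which is symmetric in \<open>m\<close>
    and \<open>n\<close> for positive indices.\<close>
  moreover have "conj_chain a b f m \<circ>\<^sub>p conj_chain a b f n = conj_chain a b (\<lambda>_. f m \<circ>\<^sub>p f n) 0" for m n
    unfolding conj_chain_def using linear_poly_inv[OF assms(2)]
    by (metis pcompose_assoc pcompose_X_left)
  ultimately show ?thesis
    using assms by (simp add: is_chain_def)
qed

section \<open>Coefficients of monic chains\<close>

text \<open>Leading coefficients in the commutation of \<open>f n\<close> with the monic
  \<open>f 2\<close> give l = l^2 for the nonzero leading coefficient l of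
  \<open>f n\<close>.\<close>

lemma chain_monic:
  assumes "is_chain f" "lead_coeff (f 2) = 1" "n \<ge> 1"
  shows "lead_coeff (f n) = 1"
proof -
  have deg: "degree (f n) = n" "degree (f 2) = 2" "f n \<circ>\<^sub>p f 2 = f 2 \<circ>\<^sub>p f n"
    using assms by (auto simp: is_chain_def)
  have "lead_coeff (f n) * lead_coeff (f 2) ^ n = lead_coeff (f 2) * lead_coeff (f n) ^ 2"
    using lead_coeff_comp[of "f 2" "f n"] lead_coeff_comp[of "f n" "f 2"] deg assms(3) by simp
  moreover have "lead_coeff (f n) \<noteq> 0"
    unfolding leading_coeff_0_iff using deg assms(3) by auto
  ultimately show ?thesis
    using assms(2) by (simp add: power2_eq_square)
qed

lemma poly_eq_Poly_coeffs:
  "p \<noteq> 0 \<Longrightarrow> p = Poly (map (coeff p) [0..<Suc (degree p)])"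
  using Poly_coeffs[of p] by (simp add: coeffs_def)

lemma chain_monic_coeffs:
  assumes "is_chain f" "lead_coeff (f 2) = 1"
  shows "\<exists>b c. f 2 = [:c, b, 1:]" "\<exists>c b a. f 3 = [:c, b, a, 1:]"
    "\<exists>e d c b a. f 5 = [:e, d, c, b, a, 1:]"
proof -
  have f: "f n = Poly (map (coeff (f n)) [0..<Suc n])" "coeff (f n) n = 1" if "n \<ge> 1" for n
  proof -
    have "degree (f n) = n" using assms that by (simp add: is_chain_def)
    then show "coeff (f n) n = 1" using chain_monic[OF assms that] by simp
    then have "f n \<noteq> 0" by auto
    then show "f n = Poly (map (coeff (f n)) [0..<Suc n])"
      using poly_eq_Poly_coeffs \<open>degree (f n) = n\<close> by metis
  qed
  have "f 2 = [:coeff (f 2) 0, coeff (f 2) 1, 1:]"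
    using f[of 2] by (simp add: upt_rec eval_nat_numeral)
  then show "\<exists>b c. f 2 = [:c, b, 1:]" by blast
  have "f 3 = [:coeff (f 3) 0, coeff (f 3) 1, coeff (f 3) 2, 1:]"
    using f[of 3] by (simp add: upt_rec eval_nat_numeral)
  then show "\<exists>c b a. f 3 = [:c, b, a, 1:]" by blast
  have "f 5 = [:coeff (f 5) 0, coeff (f 5) 1, coeff (f 5) 2, coeff (f 5) 3, coeff (f 5) 4, 1:]"
    using f[of 5] by (simp add: upt_rec eval_nat_numeral)
  then show "\<exists>e d c b a. f 5 = [:e, d, c, b, a, 1:]" by blast
qed

section \<open>Uniqueness of commuting polynomials\<close>

text \<open>If P - R were nonzero of degree d, then (P - R)(h) = (P - R) S would give d (m + 1) = d
  + m n, so d = n; but equal leading coefficients force d < n.\<close>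

lemma commuting_poly_unique:
  fixes h P R S :: "'a::field poly"
  assumes "P \<circ>\<^sub>p h = h \<circ>\<^sub>p P" "R \<circ>\<^sub>p h = h \<circ>\<^sub>p R"
    and factor: "h \<circ>\<^sub>p P - h \<circ>\<^sub>p R = (P - R) * S"
    and deg: "degree P = n" "degree R = n" "degree h = Suc m" "degree S = m * n" "m > 0" "n > 0"
    and lead: "lead_coeff P = lead_coeff R"
  shows "P = R"
proof (rule ccontr)
  assume "P \<noteq> R"
  then have D: "P - R \<noteq> 0" by simp
  have S: "S \<noteq> 0" using deg by auto
  have "degree (P - R) \<le> n"
    using degree_diff_le[of P n R] deg by simp
  moreover have "degree (P - R) \<noteq> n"
    using D lead deg by (metis coeff_diff leading_coeff_0_iff right_minus_eq)
  ultimately have less: "degree (P - R) < n" by simp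
  have "(P - R) \<circ>\<^sub>p h = (P - R) * S"
    using assms by (simp add: pcompose_diff)
  then have "degree (P - R) * Suc m = degree (P - R) + m * n"
    using D S deg by (metis degree_mult_eq degree_pcompose)
  then have "m * degree (P - R) = m * n" by (simp add: algebra_simps)
  with deg less show False by simp
qed

lemma degree_eqI: "degree P \<le> n \<Longrightarrow> coeff P n \<noteq> 0 \<Longrightarrow> degree P = n"
  using le_degree by (metis antisym)

lemma chains_eq_if_quadratic_eq:
  fixes f g :: "nat \<Rightarrow> 'a::field poly"
  assumes "is_chain f" "is_chain g" "f 2 = g 2" "lead_coeff (f 2) = 1" "(2::'a) \<noteq> 0" "n \<ge> 1"
  shows "f n = g n"
proof -
  have deg: "degree (f n) = n" "degree (g n) = n" "degree (f 2) = 2"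
    using assms by (auto simp: is_chain_def)
  have lead: "coeff (f n) n = 1" "coeff (g n) n = 1"
    using chain_monic[of f n] chain_monic[of g n] assms deg by auto
  obtain u v where h: "f 2 = [:v, u, 1:]"
    using chain_monic_coeffs(1)[OF assms(1,4)] by blast
  \<comment> \<open>The cofactor of P - R in (P^2 + u P) - (R^2 + u R). Its coefficient at
    \<open>n\<close> is 2, so its degree is exactly \<open>n\<close> when 2 is nonzero.\<close>
  define S where "S = f n + g n + [:u:]"
  have "degree S = n"
  proof (rule degree_eqI)
    show "degree S \<le> n"
      unfolding S_def by (intro degree_add_le) (use deg in auto)
    show "coeff S n \<noteq> 0"
      using lead assms(5,6) by (simp add: S_def coeff_pCons split: nat.splits)
  qed
  moreover have "f 2 \<circ>\<^sub>p f n - f 2 \<circ>\<^sub>p g n = (f n - g n) * S"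
    by (simp add: h S_def pcompose_pCons algebra_simps)
  moreover have "f n \<circ>\<^sub>p f 2 = f 2 \<circ>\<^sub>p f n" "g n \<circ>\<^sub>p g 2 = g 2 \<circ>\<^sub>p g n"
    using assms unfolding is_chain_def by (meson one_le_numeral)+
  ultimately show ?thesis
    using deg lead assms(3,6)
    by - (rule commuting_poly_unique[where h = "f 2" and m = 1 and n = n], auto)
qed

lemma chains_eq_if_cubic_eq:
  fixes f g :: "nat \<Rightarrow> 'a::field poly"
  assumes "is_chain f" "is_chain g" "f 3 = g 3" "lead_coeff (f 2) = 1" "lead_coeff (g 2) = 1"
    "(3::'a) \<noteq> 0" "n \<ge> 1"
  shows "f n = g n"
proof -
  have deg: "degree (f n) = n" "degree (g n) = n" "degree (f 3) = 3"
    using assms by (auto simp: is_chain_def)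
  have lead: "coeff (f n) n = 1" "coeff (g n) n = 1" "coeff (f 3) 3 = 1"
    using chain_monic[of f n] chain_monic[of g n] chain_monic[of f 3] assms deg by auto
  obtain u v w where h: "f 3 = [:w, v, u, 1:]"
    using chain_monic_coeffs(2)[OF assms(1,4)] by blast
  \<comment> \<open>The cofactor of P - R for a monic cubic. Its coefficient at \<open>2 * n\<close>
    is 3, one from each of the three products.\<close>
  define S where "S = (f n * f n + f n * g n + g n * g n) + (smult u (f n + g n) + [:v:])"
  have "degree S = 2 * n"
  proof (rule degree_eqI)
    have "degree (f n * f n + f n * g n + g n * g n) \<le> 2 * n"
      using degree_mult_le[of "f n" "f n"] degree_mult_le[of "f n" "g n"]
        degree_mult_le[of "g n" "g n"] deg by (intro degree_add_le) auto
    moreover have *: "degree (smult u (f n + g n) + [:v:]) \<le> n"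
      by (intro degree_add_le order_trans[OF degree_smult_le]) (use deg in auto)
    ultimately show "degree S \<le> 2 * n"
      unfolding S_def by (rule degree_add_le[OF _ order_trans]) auto
    have "coeff (smult u (f n + g n) + [:v:]) (2 * n) = 0"
      using * assms(7) by (intro coeff_eq_0) simp
    moreover have "coeff (f n * f n) (2 * n) = 1" "coeff (f n * g n) (2 * n) = 1"
      "coeff (g n * g n) (2 * n) = 1"
      using coeff_mult_degree_sum[of "f n" "f n"] coeff_mult_degree_sum[of "f n" "g n"]
        coeff_mult_degree_sum[of "g n" "g n"] deg lead by (simp_all add: mult_2)
    ultimately have "coeff S (2 * n) = 3"
      unfolding S_def by (simp only: coeff_add) simp
    with assms(6) show "coeff S (2 * n) \<noteq> 0" by simp
  qed
  moreover have "f 3 \<circ>\<^sub>p f n - f 3 \<circ>\<^sub>p g n = (f n - g n) * S"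
  proof -
    have "(W + P * (V + P * (U + P))) - (W + R * (V + R * (U + R))) =
        (P - R) * ((P * P + P * R + R * R) + (U * (P + R) + V))" for P R U V W :: "'a poly"
      by algebra
    from this[of "[:w:]" "f n" "[:v:]" "[:u:]" "g n"] show ?thesis
      by (simp add: h S_def pcompose_pCons)
  qed
  moreover have "f n \<circ>\<^sub>p f 3 = f 3 \<circ>\<^sub>p f n" "g n \<circ>\<^sub>p g 3 = g 3 \<circ>\<^sub>p g n"
    using assms unfolding is_chain_def by (meson one_le_numeral)+
  ultimately show ?thesis
    using deg lead assms(3,7)
    by - (rule commuting_poly_unique[where h = "f 3" and m = 2 and n = n], auto)
qed

section \<open>The power chain and the reduced Chebyshev chain\<close>

lemma is_chain_monom: "is_chain (\<lambda>n. monom (1::'a::field) n)"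
  by (auto simp: is_chain_def degree_monom_eq pcompose_monom monom_power mult.commute)

lemma F_int_eq_F_aux: "F_int n = F_aux n"
proof -
  have "map_poly of_int (F_int n) = (map_poly of_int (F_aux n) :: rat poly)"
    by (simp add: of_int_F_aux F_int)
  then show ?thesis
    by (auto simp: poly_eq_iff coeff_map_poly)
qed

lemma G_poly_simps:
  "G_poly 0 = 0"
  "G_poly (Suc 0) = [:0, 1:]"
  "G_poly (Suc (Suc n)) = [:2, 1:] * G_poly (Suc n) - G_poly n + [:0, 2:]"
  unfolding G_poly_def F_int_eq_F_aux
  by (simp_all add: map_poly_pCons)
    (rule poly_eqI, simp add: coeff_map_poly coeff_pCons split: nat.split)

text \<open>
  With \<open>x + 2 = y + y\<^sup>-\<^sup>1\<close> this is \<open>(y\<^sup>m + y\<^sup>-\<^sup>m) (y\<^sup>m\<^sup>+\<^sup>n + y\<^sup>-\<^sup>m\<^sup>-\<^sup>n) = (y\<^sup>2\<^sup>m\<^sup>+\<^sup>n + y\<^sup>-\<^sup>2\<^sup>m\<^sup>-\<^sup>n) + (y\<^sup>n + y\<^sup>-\<^sup>n)\<close>.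
\<close>
lemma G_poly_product:
  "(G_poly m + 2) * (G_poly (n + m) + 2) = (G_poly (n + 2 * m) + 2) + (G_poly n + 2)"
proof -
  \<comment> \<open>Adding 2 turns the inhomogeneous recursion of \<open>G_poly\<close> into the
    homogeneous one of 2 T_n(z / 2), with z = x + 2.\<close>
  define H :: "nat \<Rightarrow> 'a poly" where "H n = G_poly n + 2" for n
  define z :: "'a poly" where "z = [:2, 1:]"
  have "[:0, 2:] = 2 * z - 4"
    by (simp add: z_def numeral_poly)
  then have G: "G_poly (Suc (Suc n)) = z * G_poly (Suc n) - G_poly n + (2 * z - 4)" for n
    by (simp only: G_poly_simps z_def)
  have H: "H 0 = 2" "H (Suc 0) = z" "H (Suc (Suc n)) = z * H (Suc n) - H n" for n
    by (simp_all add: H_def G G_poly_simps(1,2) algebra_simps) (simp add: z_def numeral_poly)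
  have "H m * H (n + m) = H (n + 2 * m) + H n"
  proof (induction m arbitrary: n rule: cheb_T.induct)
    case (3 m)
    \<comment> \<open>Only the first factor is expanded. The index of the second is regrouped as (n
      + 1) + (m + 1) and (n + 2) + m, which is why \<open>n\<close> is arbitrary in the
      induction.\<close>
    have "H (Suc (Suc m)) * H (n + Suc (Suc m)) =
        z * (H (Suc m) * H (Suc n + Suc m)) - H m * H (Suc (Suc n) + m)"
      by (simp add: H algebra_simps)
    also have "\<dots> = z * (H (Suc n + 2 * Suc m) + H (Suc n)) - (H (Suc (Suc n) + 2 * m) + H (Suc (Suc n)))"
      by (simp only: 3)
    also have "\<dots> = H (n + 2 * Suc (Suc m)) + H n"
      by (simp add: H algebra_simps)
    finally show ?case .
  qed (simp_all add: H algebra_simps)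
  then show ?thesis by (simp add: H_def)
qed

text \<open>The composition law of the Chebyshev polynomials. Substituting \<open>G_poly n\<close>
  into the recursion in \<open>m\<close> gives the recursion of \<open>G_poly\<close> along
  multiples of \<open>n\<close>, an instance of the product formula valid in every
  characteristic.\<close>

lemma G_poly_pcompose: "G_poly m \<circ>\<^sub>p G_poly n = (G_poly (m * n) :: 'a::field poly)"
proof (induction m rule: cheb_T.induct)
  case (3 m)
  have [simp]: "(2 :: 'a poly) \<circ>\<^sub>p q = 2" for q by (simp add: numeral_poly)
  have G: "G_poly (Suc (Suc m)) = (G_poly 1 + 2) * (G_poly (Suc m) + 2) - (G_poly m + 2) - (2 :: 'a poly)"
    using G_poly_product[of 1 m, where 'a = 'a] by (simp add: eq_diff_eq ac_simps)
  have [simp]: "G_poly (Suc 0) \<circ>\<^sub>p q = (q :: 'a poly)" for q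
    by (simp add: G_poly_simps pcompose_X_left)
  have "(G_poly n + 2) * (G_poly (m * n + n) + 2) = (G_poly (m * n + 2 * n) + 2) + (G_poly (m * n) + 2 :: 'a poly)"
    by (rule G_poly_product)
  moreover have "G_poly (n + (n + m * n)) = (G_poly (m * n + 2 * n) :: 'a poly)"
    by (rule arg_cong[where f = G_poly]) simp
  ultimately show ?case
    using 3 by (simp add: G pcompose_add pcompose_diff pcompose_mult algebra_simps)
qed (simp_all add: G_poly_simps pcompose_pCons)

lemma degree_G_poly: "n \<ge> 1 \<Longrightarrow> degree (G_poly n :: 'a::field poly) = n"
proof -
  assume n: "n \<ge> 1"
  have c: "coeff (G_poly n :: 'a poly) n = 1"
    using F_int(2,3)[of n] n by (simp add: G_poly_def coeff_map_poly)
  have "degree (G_poly n :: 'a poly) \<le> n"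
    unfolding G_poly_def by (metis map_poly_degree_leq F_int(2))
  with c show ?thesis
    using degree_eqI[of "G_poly n :: 'a poly" n] by simp
qed

lemma is_chain_G_poly: "is_chain G_poly"
  by (simp add: is_chain_def degree_G_poly G_poly_pcompose mult.commute)

lemma G_poly_2: "G_poly 2 = [:0, 4, 1 :: 'a::field:]"
  by (simp add: numeral_2_eq_2 G_poly_simps)

lemma G_poly_3: "G_poly 3 = [:0, 9, 6, 1 :: 'a::field:]"
  by (simp add: numeral_3_eq_3 G_poly_simps)

text \<open>Degrees 2 and 3 already conflict: their coefficients force a = 1 and b = 2, then 2 = 0,
  and finally 9 = 0 although 9 = 1.\<close>

lemma not_similar_monom_G_poly: "\<not> similar_chains (\<lambda>n. monom (1::'a::field) n) G_poly"
proof
  assume "similar_chains (\<lambda>n. monom (1::'a::field) n) G_poly"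
  then obtain a b :: 'a where a: "a \<noteq> 0"
    and eq: "\<And>n. n \<ge> 1 \<Longrightarrow> linear_poly a b \<circ>\<^sub>p G_poly n = monom 1 n \<circ>\<^sub>p linear_poly a b"
    by (auto simp: similar_chains_iff)
  have 2: "a * 1 = a * a" "a * 4 = 2 * a * b" "b = b * b"
    using eq[of 2] by (simp_all add: G_poly_2 linear_poly_def pcompose_monom pcompose_pCons power2_eq_square)
  have 3: "a * 6 = 3 * a * a * b" "a * 9 = 3 * a * b * b"
    using eq[of 3] by (simp_all add: G_poly_3 linear_poly_def pcompose_monom pcompose_pCons power3_eq_cube)
  have "a = 1" using 2(1) a by simp
  with 2 3 have b: "2 * b = 4" "3 * b = 6" "b * b = b" "6 * b = 9"
    by simp_all
  \<comment> \<open>Subtraction replaces division by 2 or 3, either of which may vanish.\<close>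
  have "b = 3 * b - 2 * b" by simp
  also have "\<dots> = 2" by (simp only: b) simp
  finally have "b = 2" .
  with b(3) have "(2::'a) + 2 = 2 + 0" by simp
  then have "(2::'a) = 0" by (simp only: add_left_cancel)
  with \<open>b = 2\<close> have "b = 0" by (rule trans)
  with b(4) have "(9::'a) = 0" by simp
  moreover have "(9::'a) = 2 * 4 + 1" by simp
  ultimately show False using \<open>2 = 0\<close> by simp
qed

section \<open>Normalisation and low-degree coefficient constraints\<close>

text \<open>Conjugation by x / A, with A the leading coefficient of \<open>f 2\<close>, produces A
  f_2(x / A), whose leading coefficient is A A / A^2 = 1.\<close>

lemma chain_similar_monic:
  assumes "is_chain (f :: nat \<Rightarrow> 'a::field poly)"
  obtains g where "is_chain g" "similar_chains f g" "lead_coeff (g 2) = 1"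
proof
  define A where "A = lead_coeff (f 2)"
  have deg: "degree (f 2) = 2" using assms by (auto simp: is_chain_def)
  then have A2: "coeff (f 2) 2 = A" by (simp add: A_def)
  have A: "A \<noteq> 0" using deg unfolding A_def leading_coeff_0_iff by auto
  show "is_chain (conj_chain (1 / A) 0 f)" "similar_chains f (conj_chain (1 / A) 0 f)"
    using A assms by (auto intro: is_chain_conj_chain similar_conj_chain)
  show "lead_coeff (conj_chain (1 / A) 0 f 2) = 1"
    using A deg A2 lead_coeff_comp[of "f 2 \<circ>\<^sub>p [:0, 1 / A:]" "[:0, A:]"]
      lead_coeff_comp[of "[:0, 1 / A:]" "f 2"]
    by (simp add: conj_chain_def linear_poly_def linear_poly_inv_def degree_pcompose
        power2_eq_square)
qed

text \<open>Squaring the quintic puts twice its coefficient at 5 - i into degree 10 - i, and 2 = -1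
  is invertible. So degrees 9 down to 5 determine all coefficients in turn, and degree 4 is then
  contradictory.\<close>

lemma no_quintic_commutes_char_3:
  fixes u v w x y :: "'a::field"
  assumes E: "[:y, x, w, v, u, 1:] \<circ>\<^sub>p [:-1, 0, 1:] = [:-1, 0, 1:] \<circ>\<^sub>p [:y, x, w, v, u, 1:]"
    and 3: "(3::'a) = 0"
  shows False
proof -
  have 2: "2 = (-1::'a)" using 3 by (simp add: eq_neg_iff_add_eq_0)
  note C = arg_cong[OF E, of "\<lambda>p. coeff p k" for k]
  have u: "u = 0" using C[of 9] 2 by (simp add: pcompose_pCons coeff_pCons)
  note C = C[unfolded u]
  have "-v = 1" using C[of 8] 2 by (simp add: pcompose_pCons coeff_pCons)
  then have v: "v = -1" by algebra
  note C = C[unfolded v]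
  have w: "w = 0" using C[of 7] 2 by (simp add: pcompose_pCons coeff_pCons)
  note C = C[unfolded w]
  have x: "x = 1" using C[of 6] 2 by (simp add: pcompose_pCons coeff_pCons)
  note C = C[unfolded x]
  have y: "y = 0" using C[of 5] 2 by (simp add: pcompose_pCons coeff_pCons)
  note C = C[unfolded y]
  show False using C[of 4] 2 by (simp add: pcompose_pCons coeff_pCons)
qed

lemma chain_quadratic_const_cases:
  fixes f :: "nat \<Rightarrow> 'a::field poly"
  assumes "is_chain f" "f 2 = [:c, 0, 1:]" "(2::'a) \<noteq> 0"
  shows "c = 0 \<or> c = -2"
proof (rule ccontr)
  assume c: "\<not> ?thesis"
  have lead: "lead_coeff (f 2) = 1" using assms by simp
  obtain r s t where f3: "f 3 = [:t, s, r, 1:]"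
    using chain_monic_coeffs(2)[OF assms(1) lead] by blast
  obtain u v w x y where f5: "f 5 = [:y, x, w, v, u, 1:]"
    using chain_monic_coeffs(3)[OF assms(1) lead] by blast
  have "f 3 \<circ>\<^sub>p f 2 = f 2 \<circ>\<^sub>p f 3"
    using assms(1) by (auto simp: is_chain_def)
  then have E: "[:t, s, r, 1:] \<circ>\<^sub>p [:c, 0, 1:] = [:c, 0, 1:] \<circ>\<^sub>p [:t, s, r, 1:]"
    by (simp only: assms(2) f3)
  note C = arg_cong[OF E, of "\<lambda>p. coeff p k" for k]
  have r: "r = 0" using C[of 5] assms(3) by (simp add: pcompose_pCons coeff_pCons flip: mult_2)
  have t: "t = 0" using C[of 3] assms(3) by (simp add: pcompose_pCons coeff_pCons r flip: mult_2)
  have eqs: "3 * c = 2 * s" "s + 3 * c * c = s * s" "c * s + c * c * c = c"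
    using C[of 4] C[of 2] C[of 0] by (simp_all add: pcompose_pCons coeff_pCons r t algebra_simps)
  \<comment> \<open>Four times the second relation, with 2 s replaced by 3 c, eliminates
    \<open>s\<close>.\<close>
  have "3 * (c * (c + 2)) = 0" using eqs(1,2) by algebra
  with c have 3: "(3::'a) = 0" by (auto simp: eq_neg_iff_add_eq_0)
  with eqs(1) assms(3) have "s = 0" by simp
  with eqs(3) c have "c * c = 1" by simp
  then have "c = 1 \<or> c = -1" by (simp add: square_eq_1_iff)
  \<comment> \<open>In characteristic 3 the root c = 1 is the admissible value -2, so only c = -1
    remains.\<close>
  moreover have "1 = (-2::'a)" using 3 by (simp add: eq_neg_iff_add_eq_0)
  ultimately have "c = -1" using c by auto
  moreover have "f 5 \<circ>\<^sub>p f 2 = f 2 \<circ>\<^sub>p f 5"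
    using assms(1) by (auto simp: is_chain_def)
  ultimately have "[:y, x, w, v, u, 1:] \<circ>\<^sub>p [:-1, 0, 1:] = [:-1, 0, 1:] \<circ>\<^sub>p [:y, x, w, v, u, 1:]"
    by (simp only: assms(2) f5)
  then show False using 3 by (rule no_quintic_commutes_char_3)
qed

text \<open>Cubing the quintic puts three times its coefficient at 5 - i into degree 15 - i, and 3 =
  1. Degrees 14 down to 10 thus determine the quintic in terms of \<open>a\<close> and
  \<open>d\<close>, and degree 9 leaves d = 0.\<close>

lemma quintic_commutes_char_2:
  fixes a d u v w x y :: "'a::field"
  assumes E: "[:y, x, w, v, u, 1:] \<circ>\<^sub>p [:d, a, 0, 1:] = [:d, a, 0, 1:] \<circ>\<^sub>p [:y, x, w, v, u, 1:]"
    and 2: "(2::'a) = 0" and a: "a * a = a" and d: "d * d = d"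
  shows "d = 0"
proof -
  note C = arg_cong[OF E, of "\<lambda>p. coeff p k" for k]
  have u: "u = 0" using C[of 14] 2 by (simp add: pcompose_pCons coeff_pCons)
  note C = C[unfolded u]
  have v: "v = a" using C[of 13] 2 by (simp add: pcompose_pCons coeff_pCons)
  note C = C[unfolded v]
  have w: "w = d" using C[of 12] 2 by (simp add: pcompose_pCons coeff_pCons)
  note C = C[unfolded w]
  have "a + x = 0" using C[of 11] 2 a by (simp add: pcompose_pCons coeff_pCons)
  moreover have "a + a = 0" using 2 by (simp flip: mult_2)
  ultimately have x: "x = a" by (metis add_left_cancel)
  note C = C[unfolded x]
  have y: "y = 0" using C[of 10] 2 by (simp add: pcompose_pCons coeff_pCons)
  note C = C[unfolded y]
  show "d = 0" using C[of 9] 2 a d by (simp add: pcompose_pCons coeff_pCons)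
qed

lemma chain_cubic_cases_char_2:
  fixes f :: "nat \<Rightarrow> 'a::field poly"
  assumes "is_chain f" "f 2 = [:c, b, 1:]" "f 3 = [:d, a, 0, 1:]" "(2::'a) = 0"
  shows "d = 0 \<and> (a = 0 \<or> a = 1)"
proof -
  have "(3::'a) = 2 + 1" by simp
  then have 3: "(3::'a) = 1" using assms(4) by (simp only: add_0)
  have lead: "lead_coeff (f 2) = 1" using assms by simp
  obtain u v w x y where f5: "f 5 = [:y, x, w, v, u, 1:]"
    using chain_monic_coeffs(3)[OF assms(1) lead] by blast
  have "f 3 \<circ>\<^sub>p f 2 = f 2 \<circ>\<^sub>p f 3"
    using assms(1) by (auto simp: is_chain_def)
  then have E: "[:d, a, 0, 1:] \<circ>\<^sub>p [:c, b, 1:] = [:c, b, 1:] \<circ>\<^sub>p [:d, a, 0, 1:]"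
    by (simp only: assms(2,3))
  note C = arg_cong[OF E, of "\<lambda>p. coeff p k" for k]
  have b: "b = 0" using C[of 5] assms(4) 3 by (simp add: pcompose_pCons coeff_pCons)
  note C = C[unfolded b]
  have c: "c = 0" using C[of 4] assms(4) by (simp add: pcompose_pCons coeff_pCons)
  \<comment> \<open>Now \<open>f 2\<close> is the Frobenius map x^2, so commuting with it means that
    squaring fixes every coefficient of \<open>f 3\<close>.\<close>
  have a: "a * a = a" and d: "d * d = d"
    using C[of 2] C[of 0] by (simp_all add: pcompose_pCons coeff_pCons c)
  have "f 5 \<circ>\<^sub>p f 3 = f 3 \<circ>\<^sub>p f 5"
    using assms(1) by (auto simp: is_chain_def)
  then have "[:y, x, w, v, u, 1:] \<circ>\<^sub>p [:d, a, 0, 1:] = [:d, a, 0, 1:] \<circ>\<^sub>p [:y, x, w, v, u, 1:]"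
    by (simp only: assms(3) f5)
  then have "d = 0" using assms(4) a d by (rule quintic_commutes_char_2)
  with a show ?thesis by simp
qed

section \<open>Classification\<close>

lemma chain_classification:
  fixes f :: "nat \<Rightarrow> 'a::field poly"
  assumes "is_chain f"
  shows "similar_chains f (\<lambda>n. monom 1 n) \<or> similar_chains f G_poly"
proof -
  obtain g where g: "is_chain g" "similar_chains f g" "lead_coeff (g 2) = 1"
    using chain_similar_monic[OF assms] .
  obtain b c where g2: "g 2 = [:c, b, 1:]"
    using chain_monic_coeffs(1)[OF g(1,3)] by blast
  obtain t s r where g3: "g 3 = [:t, s, r, 1:]"
    using chain_monic_coeffs(2)[OF g(1,3)] by blast
  have "similar_chains g (\<lambda>n. monom 1 n) \<or> similar_chains g G_poly"
  proof (cases "(2::'a) = 0")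
    case False
    \<comment> \<open>Completing the square removes the linear term of \<open>g 2\<close>.\<close>
    define h where "h = conj_chain 1 (- b / 2) g"
    have h: "is_chain h" "similar_chains g h"
      by (simp_all add: h_def is_chain_conj_chain[OF g(1)] similar_conj_chain)
    obtain e where h2: "h 2 = [:e, 0, 1:]"
      using False
      by (simp add: h_def conj_chain_def g2 linear_poly_def linear_poly_inv_def pcompose_pCons)
    have "e = 0 \<or> e = -2"
      by (rule chain_quadratic_const_cases[OF h(1) h2 False])
    then show ?thesis
    proof
      assume e: "e = 0"
      have "h n = monom 1 n" if "n \<ge> 1" for n
        by (rule chains_eq_if_quadratic_eq[OF h(1) is_chain_monom _ _ False that])
          (use h2 e in \<open>simp_all add: monom_altdef power2_eq_square\<close>)
      then have "similar_chains h (\<lambda>n. monom 1 n)"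
        by (rule similar_chains_if_eq)
      then show ?thesis using h(2) similar_chains_trans by blast
    next
      assume e: "e = -2"
      \<comment> \<open>The shift by 2 turns x^2 - 2 into (x + 2)^2 - 4 = x^2 + 4 x, which is
        \<open>G_poly 2\<close>.\<close>
      have "conj_chain 1 2 h n = G_poly n" if "n \<ge> 1" for n
        by (rule chains_eq_if_quadratic_eq
            [OF is_chain_conj_chain[OF h(1)] is_chain_G_poly _ _ False that])
          (use h2 e in \<open>simp_all add: conj_chain_def linear_poly_def linear_poly_inv_def
            pcompose_pCons G_poly_2\<close>)
      then have "similar_chains h G_poly"
        unfolding similar_chains_def conj_chain_def by (metis one_neq_zero)
      then show ?thesis using h(2) similar_chains_trans by blast
    qed
  next
    case True
    have "(3::'a) = 2 + 1" by simp
    then have 3: "(3::'a) = 1" using True by (simp only: add_0)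
    \<comment> \<open>The cubic analogue: this shift removes the quadratic term of
      \<open>g 3\<close>.\<close>
    define h where "h = conj_chain 1 (- r / 3) g"
    have h: "is_chain h" "similar_chains g h"
      by (simp_all add: h_def is_chain_conj_chain[OF g(1)] similar_conj_chain)
    obtain b' c' where h2: "h 2 = [:c', b', 1:]"
      by (simp add: h_def conj_chain_def g2 linear_poly_def linear_poly_inv_def pcompose_pCons)
    obtain a d where h3: "h 3 = [:d, a, 0, 1:]"
      using 3 True
      by (simp add: h_def conj_chain_def g3 linear_poly_def linear_poly_inv_def pcompose_pCons)
    have "d = 0" "a = 0 \<or> a = 1"
      using chain_cubic_cases_char_2[OF h(1) h2 h3 True] by auto
    from this(2) show ?thesis
    proof
      assume a: "a = 0"
      have "h n = monom 1 n" if "n \<ge> 1" for n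
        by (rule chains_eq_if_cubic_eq[OF h(1) is_chain_monom _ _ _ _ that])
          (use 3 h2 h3 a \<open>d = 0\<close> in \<open>simp_all add: degree_monom_eq monom_altdef
            power2_eq_square power3_eq_cube\<close>)
      then have "similar_chains h (\<lambda>n. monom 1 n)"
        by (rule similar_chains_if_eq)
      then show ?thesis using h(2) similar_chains_trans by blast
    next
      assume "a = 1"
      \<comment> \<open>Modulo 2, x^3 + 6 x^2 + 9 x is x^3 + x, so no further translation is needed
        to reach \<open>G_poly 3\<close>.\<close>
      have "(6::'a) = 2 * 3" "(9::'a) = 3 * 3" by simp_all
      then have G3: "h 3 = G_poly 3"
        using True 3 \<open>a = 1\<close> \<open>d = 0\<close> by (simp only: G_poly_3 h3) simp
      have "h n = G_poly n" if "n \<ge> 1" for n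
        by (rule chains_eq_if_cubic_eq[OF h(1) is_chain_G_poly _ _ _ _ that])
          (use 3 h2 G3 in \<open>simp_all add: G_poly_2\<close>)
      then have "similar_chains h G_poly"
        by (rule similar_chains_if_eq)
      then show ?thesis using h(2) similar_chains_trans by blast
    qed
  qed
  then show ?thesis using g(2) similar_chains_trans by blast
qed

theorem theorem1p9:
  fixes f :: "nat \<Rightarrow> 'a::field poly" and p :: nat
  assumes "CHAR('a) = p" and "p > 0"
    and "is_chain f"
  shows "(similar_chains f (\<lambda>n. monom 1 n) \<and> \<not> similar_chains f G_poly) \<or>
         (\<not> similar_chains f (\<lambda>n. monom 1 n) \<and> similar_chains f G_poly)"
  \<comment> \<open>Similarity to both model chains would make them similar to each other.\<close>
  using chain_classification[OF assms(3)] not_similar_monom_G_poly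
    similar_chains_sym similar_chains_trans by blast

end
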